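(* Let $\Omega_1,\Omega_2$ be two domains in $\mathbb{C}$. For each $n\in\mathbb{Z}$ let $T_n:\mathcal{H}ol(\Omega_1)\to\mathcal{H}ol(\Omega_2)$ be a linear operator such that for every $z\in\Omega_2$ the function $\mathcal{H}ol(\Omega_1)\ni f\mapsto T_n(f)(z)\in\mathbb{C}$ is continuous, and let $\mathcal{U}_{T_n}=\{f\in\mathcal{H}ol(\Omega_1): T_n(f)\text{ is unbounded on }\Omega_2\}$. If $\mathcal{U}_{T_n}\neq\emptyset$ for all $n\in\mathbb{Z}$, then the set $\bigcap_{n\in\mathbb{Z}}\mathcal{U}_{T_n}$ is a dense $G_\delta$ set in $\mathcal{H}ol(\Omega_1)$.
   Context: A domain is an open connected subset of $\mathbb{C}$. For an open set $\Omega\subset\mathbb{C}$, $\mathcal{H}ol(\Omega)$ is the space of all holomorphic functions on $\Omega$ with the topology of uniform convergence on compact subsets of $\Omega$. A $G_\delta$ set is a countable intersection of open sets; a dense $G_\delta$ set is a $G_\delta$ set that is also dense. *)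

theory Defs
  imports "HOL-Analysis.Analysis"
begin

definition complex_domain :: "complex set \<Rightarrow> bool"
  where "complex_domain \<Omega> \<longleftrightarrow> open \<Omega> \<and> connected \<Omega>"

text \<open>Functions in HOL are total, so a holomorphic function on \<open>\<Omega>\<close> is represented by its
  extension by zero. This makes equality of elements of \<open>Hol \<Omega>\<close> the same as equality
  on \<open>\<Omega>\<close>, and the pointwise operations are those of a complex vector space.\<close>

definition Hol :: "complex set \<Rightarrow> (complex \<Rightarrow> complex) set"
  where "Hol \<Omega> = {f. f holomorphic_on \<Omega> \<and> (\<forall>z. z \<notin> \<Omega> \<longrightarrow> f z = 0)}"

definition Hol_ball ::
    "complex set \<Rightarrow> complex set \<Rightarrow> (complex \<Rightarrow> complex) \<Rightarrow> real \<Rightarrow> (complex \<Rightarrow> complex) set"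
  where "Hol_ball \<Omega> K f e = {g \<in> Hol \<Omega>. \<forall>z\<in>K. dist (g z) (f z) < e}"

definition Hol_topology :: "complex set \<Rightarrow> (complex \<Rightarrow> complex) topology"
  where "Hol_topology \<Omega> = topology (\<lambda>U. U \<subseteq> Hol \<Omega> \<and>
    (\<forall>f\<in>U. \<exists>K e. compact K \<and> K \<subseteq> \<Omega> \<and> 0 < e \<and> Hol_ball \<Omega> K f e \<subseteq> U))"

lemma openin_Hol_topology:
  "openin (Hol_topology \<Omega>) U \<longleftrightarrow> U \<subseteq> Hol \<Omega> \<and>
    (\<forall>f\<in>U. \<exists>K e. compact K \<and> K \<subseteq> \<Omega> \<and> 0 < e \<and> Hol_ball \<Omega> K f e \<subseteq> U)"
proof -
  let ?P = "\<lambda>U f. \<exists>K e. compact K \<and> K \<subseteq> \<Omega> \<and> 0 < e \<and> Hol_ball \<Omega> K f e \<subseteq> U"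
  have mono: "?P V f" if "?P U f" "U \<subseteq> V" for U V f
    using that by (meson subset_trans)
  have int: "?P (U \<inter> V) f" if U: "?P U f" and V: "?P V f" for U V f
  proof -
    obtain K d where K: "compact K" "K \<subseteq> \<Omega>" "0 < d" "Hol_ball \<Omega> K f d \<subseteq> U"
      using U by blast
    obtain L e where L: "compact L" "L \<subseteq> \<Omega>" "0 < e" "Hol_ball \<Omega> L f e \<subseteq> V"
      using V by blast
    have "Hol_ball \<Omega> (K \<union> L) f (min d e) \<subseteq> Hol_ball \<Omega> K f d"
      "Hol_ball \<Omega> (K \<union> L) f (min d e) \<subseteq> Hol_ball \<Omega> L f e"
      by (auto simp: Hol_ball_def)
    then have "Hol_ball \<Omega> (K \<union> L) f (min d e) \<subseteq> U \<inter> V"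
      using K(4) L(4) by blast
    moreover have "compact (K \<union> L)" "K \<union> L \<subseteq> \<Omega>" "0 < min d e"
      using K L by auto
    ultimately show ?thesis
      by blast
  qed
  have "istopology (\<lambda>U. U \<subseteq> Hol \<Omega> \<and> (\<forall>f\<in>U. ?P U f))"
    unfolding istopology_def
  proof (intro conjI allI impI)
    fix S T
    assume S: "S \<subseteq> Hol \<Omega> \<and> (\<forall>f\<in>S. ?P S f)" and T: "T \<subseteq> Hol \<Omega> \<and> (\<forall>f\<in>T. ?P T f)"
    show "S \<inter> T \<subseteq> Hol \<Omega>"
      using S by blast
    show "\<forall>f\<in>S \<inter> T. ?P (S \<inter> T) f"
    proof
      fix f
      assume "f \<in> S \<inter> T"
      show "?P (S \<inter> T) f"
      proof (rule int)
        show "?P S f" using S \<open>f \<in> S \<inter> T\<close> by simp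
        show "?P T f" using T \<open>f \<in> S \<inter> T\<close> by simp
      qed
    qed
  next
    fix \<K>
    assume \<K>: "\<forall>S\<in>\<K>. S \<subseteq> Hol \<Omega> \<and> (\<forall>f\<in>S. ?P S f)"
    show "\<Union>\<K> \<subseteq> Hol \<Omega>"
      using \<K> by blast
    show "\<forall>f\<in>\<Union>\<K>. ?P (\<Union>\<K>) f"
    proof
      fix f
      assume "f \<in> \<Union>\<K>"
      then obtain S where S: "S \<in> \<K>" "f \<in> S"
        by blast
      show "?P (\<Union>\<K>) f"
      proof (rule mono)
        show "?P S f" using bspec[OF \<K> S(1)] S(2) by simp
        show "S \<subseteq> \<Union>\<K>" using S(1) by blast
      qed
    qed
  qed
  then show ?thesis
    unfolding Hol_topology_def by (simp add: topology_inverse')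
qed

lemma topspace_Hol_topology [simp]: "topspace (Hol_topology \<Omega>) = Hol \<Omega>"
proof
  show "topspace (Hol_topology \<Omega>) \<subseteq> Hol \<Omega>"
    using openin_Hol_topology[of \<Omega> "topspace (Hol_topology \<Omega>)"] by simp
  have "openin (Hol_topology \<Omega>) (Hol \<Omega>)"
    unfolding openin_Hol_topology
  proof (intro conjI ballI exI)
    show "compact {}" "{} \<subseteq> \<Omega>" "(0::real) < 1" by auto
    show "Hol_ball \<Omega> {} f 1 \<subseteq> Hol \<Omega>" for f by (auto simp: Hol_ball_def)
  qed simp
  then show "Hol \<Omega> \<subseteq> topspace (Hol_topology \<Omega>)"
    by (rule openin_subset)
qed

lemma openin_Hol_ball:
  assumes K: "compact K" "K \<subseteq> \<Omega>" and f: "f \<in> Hol \<Omega>"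
  shows "openin (Hol_topology \<Omega>) (Hol_ball \<Omega> K f e)"
  unfolding openin_Hol_topology
proof (intro conjI ballI)
  show "Hol_ball \<Omega> K f e \<subseteq> Hol \<Omega>"
    by (auto simp: Hol_ball_def)
  fix g
  assume g: "g \<in> Hol_ball \<Omega> K f e"
  have "continuous_on K (\<lambda>z. dist (g z) (f z))"
    using f g K by (intro continuous_intros)
      (auto simp: Hol_ball_def Hol_def intro: continuous_on_subset holomorphic_on_imp_continuous_on)
  moreover have less: "dist (g z) (f z) < e" if "z \<in> K" for z
    using g that by (auto simp: Hol_ball_def)
  ultimately have "\<exists>d<e. \<forall>z\<in>K. dist (g z) (f z) \<le> d"
  proof (cases "K = {}")
    case False
    then obtain w where "w \<in> K" "\<forall>z\<in>K. dist (g z) (f z) \<le> dist (g w) (f w)"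
      using continuous_attains_sup[OF K(1)] \<open>continuous_on K (\<lambda>z. dist (g z) (f z))\<close> by blast
    then show ?thesis
      using less by blast
  qed (auto intro: lt_ex)
  then obtain d where d: "d < e" "\<forall>z\<in>K. dist (g z) (f z) \<le> d"
    by blast
  have "Hol_ball \<Omega> K g (e - d) \<subseteq> Hol_ball \<Omega> K f e"
  proof
    fix h
    assume h: "h \<in> Hol_ball \<Omega> K g (e - d)"
    have "dist (h z) (f z) < e" if "z \<in> K" for z
    proof -
      have "dist (h z) (f z) \<le> dist (h z) (g z) + dist (g z) (f z)"
        by (rule dist_triangle)
      moreover have "dist (h z) (g z) < e - d" "dist (g z) (f z) \<le> d"
        using h d that by (auto simp: Hol_ball_def)
      ultimately show ?thesis
        by linarith
    qed
    then show "h \<in> Hol_ball \<Omega> K f e"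
      using h by (auto simp: Hol_ball_def)
  qed
  then show "\<exists>L r. compact L \<and> L \<subseteq> \<Omega> \<and> 0 < r \<and> Hol_ball \<Omega> L g r \<subseteq> Hol_ball \<Omega> K f e"
    using K d by (metis diff_gt_0_iff_gt)
qed

lemma limitin_Hol_topology:
  "limitin (Hol_topology \<Omega>) f l F \<longleftrightarrow> l \<in> Hol \<Omega> \<and> (\<forall>\<^sub>F n in F. f n \<in> Hol \<Omega>) \<and>
    (\<forall>K. compact K \<and> K \<subseteq> \<Omega> \<longrightarrow> uniform_limit K f l F)"
  (is "?lhs \<longleftrightarrow> ?rhs")
proof
  assume L: ?lhs
  then have l: "l \<in> Hol \<Omega>"
    by (simp add: limitin_def)
  have ball: "\<forall>\<^sub>F n in F. f n \<in> Hol_ball \<Omega> K l e" if "compact K" "K \<subseteq> \<Omega>" "0 < e" for K e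
    using L openin_Hol_ball[OF that(1,2) l, of e] l that by (auto simp: limitin_def Hol_ball_def)
  have "\<forall>\<^sub>F n in F. f n \<in> Hol \<Omega>"
    using ball[of "{}" 1] by (simp add: Hol_ball_def)
  moreover have "uniform_limit K f l F" if "compact K \<and> K \<subseteq> \<Omega>" for K
    unfolding uniform_limit_iff
  proof (intro allI impI)
    fix e :: real
    assume "0 < e"
    with that ball[of K e] show "\<forall>\<^sub>F n in F. \<forall>x\<in>K. dist (f n x) (l x) < e"
      by (auto simp: Hol_ball_def elim: eventually_mono)
  qed
  ultimately show ?rhs
    using l by blast
next
  assume R: ?rhs
  show ?lhs
    unfolding limitin_def topspace_Hol_topology
  proof (intro conjI allI impI)
    show "l \<in> Hol \<Omega>"
      using R by blast
    fix U
    assume "openin (Hol_topology \<Omega>) U \<and> l \<in> U"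
    then obtain K e where K: "compact K" "K \<subseteq> \<Omega>" "0 < e" "Hol_ball \<Omega> K l e \<subseteq> U"
      unfolding openin_Hol_topology by blast
    have "\<forall>\<^sub>F n in F. \<forall>x\<in>K. dist (f n x) (l x) < e"
      using R K by (auto simp: uniform_limit_iff)
    moreover have "\<forall>\<^sub>F n in F. f n \<in> Hol \<Omega>"
      using R by blast
    ultimately show "\<forall>\<^sub>F n in F. f n \<in> U"
      by eventually_elim (use K(4) in \<open>auto simp: Hol_ball_def\<close>)
  qed
qed

definition linear_Hol ::
    "complex set \<Rightarrow> complex set \<Rightarrow> ((complex \<Rightarrow> complex) \<Rightarrow> complex \<Rightarrow> complex) \<Rightarrow> bool"
  where "linear_Hol \<Omega>1 \<Omega>2 T \<longleftrightarrow>
    T \<in> Hol \<Omega>1 \<rightarrow> Hol \<Omega>2 \<and>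
    (\<forall>f\<in>Hol \<Omega>1. \<forall>g\<in>Hol \<Omega>1. T (\<lambda>z. f z + g z) = (\<lambda>z. T f z + T g z)) \<and>
    (\<forall>c. \<forall>f\<in>Hol \<Omega>1. T (\<lambda>z. c * f z) = (\<lambda>z. c * T f z))"

definition unbounded_set ::
    "complex set \<Rightarrow> complex set \<Rightarrow> ((complex \<Rightarrow> complex) \<Rightarrow> complex \<Rightarrow> complex)
      \<Rightarrow> (complex \<Rightarrow> complex) set"
  where "unbounded_set \<Omega>1 \<Omega>2 T = {f \<in> Hol \<Omega>1. \<not> bounded (T f ` \<Omega>2)}"

end

theory Submission
  imports Defs "HOL-Complex_Analysis.Complex_Analysis"
begin

text \<open>Each set of unbounded functions is the intersection over \<open>k\<close> of the sets
  \<open>{f. \<exists>z\<in>\<Omega>2. k < \<bar>T\<^sub>n f z\<bar>}\<close>, which are open because point evaluations of \<open>T\<^sub>n f\<close> are continuous.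
  They are dense: if \<open>T\<^sub>n g\<close> is unbounded and \<open>T\<^sub>n f\<close> is bounded, then \<open>T\<^sub>n (f + c g)\<close> is unbounded
  for every \<open>c \<noteq> 0\<close>, and \<open>f + c g\<close> tends to \<open>f\<close> as \<open>c\<close> tends to 0. The theorem follows since
  \<open>Hol \<Omega>1\<close> is a Baire space.\<close>

section \<open>The Baire property of \<open>Hol\<close>\<close>

lemma Hol_linear_combination:
  assumes "f \<in> Hol \<Omega>" "g \<in> Hol \<Omega>"
  shows "(\<lambda>z. f z + c * g z) \<in> Hol \<Omega>"
  using assms by (auto simp: Hol_def intro!: holomorphic_intros)

lemma Hol_ball_centre: "f \<in> Hol \<Omega> \<Longrightarrow> 0 < e \<Longrightarrow> f \<in> Hol_ball \<Omega> K f e"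
  by (simp add: Hol_ball_def)

lemma Hol_ball_antimono: "L \<subseteq> K \<Longrightarrow> d \<le> e \<Longrightarrow> Hol_ball \<Omega> K f d \<subseteq> Hol_ball \<Omega> L f e"
  by (force simp: Hol_ball_def)

text \<open>Weierstrass' theorem, applied on closed discs inside \<Omega>. Vanishing of
  \<open>g\<close> off \<Omega> is a separate hypothesis because convergence on compact subsets says
  nothing there.\<close>

lemma Hol_uniform_limit:
  assumes "open \<Omega>" and f: "\<And>n. f n \<in> Hol \<Omega>" and g: "\<And>z. z \<notin> \<Omega> \<Longrightarrow> g z = 0"
    and lim: "\<And>K. compact K \<Longrightarrow> K \<subseteq> \<Omega> \<Longrightarrow> uniform_limit K f g sequentially"
  shows "g \<in> Hol \<Omega>"
proof -
  have "g holomorphic_on \<Omega>"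
  proof (rule holomorphic_uniform_sequence[OF \<open>open \<Omega>\<close>])
    show "f n holomorphic_on \<Omega>" for n
      using f by (simp add: Hol_def)
    show "\<exists>d>0. cball x d \<subseteq> \<Omega> \<and> uniform_limit (cball x d) f g sequentially" if "x \<in> \<Omega>" for x
      using that \<open>open \<Omega>\<close> lim by (meson compact_cball open_contains_cball)
  qed
  with g show ?thesis
    by (simp add: Hol_def)
qed

text \<open>Baire's nested ball argument, run on the basic neighbourhoods \<open>Hol_ball\<close>
  instead of metric balls: the compact sets exhaust \<Omega> while the radii tend to 0, so the
  centres converge locally uniformly.\<close>

theorem Hol_Baire:
  fixes V :: "nat \<Rightarrow> (complex \<Rightarrow> complex) set"
  assumes "open \<Omega>" and op: "\<And>n. openin (Hol_topology \<Omega>) (V n)"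
    and dense: "\<And>n. Hol_topology \<Omega> closure_of V n = Hol \<Omega>"
  shows "Hol_topology \<Omega> closure_of (\<Inter>n. V n) = Hol \<Omega>"
proof -
  have "(\<Inter>n. V n) \<inter> W \<noteq> {}" if W: "openin (Hol_topology \<Omega>) W" "W \<noteq> {}" for W
  proof -
    obtain C :: "nat \<Rightarrow> complex set" where C: "\<And>n. compact (C n)" "\<And>n. C n \<subseteq> \<Omega>"
      "\<And>K. compact K \<Longrightarrow> K \<subseteq> \<Omega> \<Longrightarrow> \<exists>N. \<forall>n\<ge>N. K \<subseteq> C n"
      using open_Union_compact_subsets[OF \<open>open \<Omega>\<close>] by metis
    \<comment> \<open>A triple encodes a ball by its compact set, centre and radius. Stage
      \<open>n\<close> must control \<open>C n\<close> to within 1/(n+1).\<close>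
    define P where "P n x \<longleftrightarrow> (case x of (L, f, r) \<Rightarrow> compact L \<and> L \<subseteq> \<Omega> \<and> C n \<subseteq> L \<and>
      f \<in> Hol \<Omega> \<and> 0 < r \<and> r \<le> inverse (real (Suc n)))" for n x
    \<comment> \<open>The factor 2 leaves room for the limit, which only lies in the closed balls of radius \<open>r\<close>.\<close>
    define B where "B c x = (case x of (L, f, r) \<Rightarrow> Hol_ball \<Omega> L f (c * r))" for c :: real and x
    have step: "\<exists>x. P n x \<and> B 2 x \<subseteq> U"
      if U: "openin (Hol_topology \<Omega>) U" "U \<noteq> {}" for U n
    proof -
      obtain f K e where f: "f \<in> U" and K: "compact K" "K \<subseteq> \<Omega>" "0 < e" "Hol_ball \<Omega> K f e \<subseteq> U"
        using U unfolding openin_Hol_topology by blast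
      \<comment> \<open>Halving \<open>e\<close> fits even the doubled ball into
        \<open>U\<close>.\<close>
      define r where "r = min (e / 2) (inverse (real (Suc n)))"
      have "Hol_ball \<Omega> (K \<union> C n) f (2 * r) \<subseteq> Hol_ball \<Omega> K f e"
        by (rule Hol_ball_antimono) (auto simp: r_def)
      then have "P n (K \<union> C n, f, r) \<and> B 2 (K \<union> C n, f, r) \<subseteq> U"
        using K f C(1,2) openin_subset[OF U(1)] by (auto simp: P_def B_def r_def)
      then show ?thesis ..
    qed
    have next_ball: "\<exists>y. P (Suc n) y \<and> B 2 y \<subseteq> V n \<inter> B 1 x" if x: "P n x" for n x
    proof (rule step)
      obtain L f r where x_eq: "x = (L, f, r)"
        by (cases x)
      have opB: "openin (Hol_topology \<Omega>) (B 1 x)" and "B 1 x \<noteq> {}"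
        using x openin_Hol_ball[of L \<Omega> f r] Hol_ball_centre[of f \<Omega> r L]
        by (auto simp: P_def B_def x_eq)
      then show "V n \<inter> B 1 x \<noteq> {}"
        using dense[of n] dense_intersects_open[of "Hol_topology \<Omega>" "V n"] by auto
      show "openin (Hol_topology \<Omega>) (V n \<inter> B 1 x)"
        using op opB by blast
    qed
    obtain x where x: "\<And>n. P n (x n)" "B 2 (x 0) \<subseteq> W"
      "\<And>n. B 2 (x (Suc n)) \<subseteq> V n \<inter> B 1 (x n)"
    proof -
      \<comment> \<open>The clause for \<open>n = 0\<close> carries the start inside
        \<open>W\<close> through dependent choice.\<close>
      have "\<exists>x. \<forall>n. (P n (x n) \<and> (n = 0 \<longrightarrow> B 2 (x n) \<subseteq> W)) \<and>
        B 2 (x (Suc n)) \<subseteq> V n \<inter> B 1 (x n)"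
        by (rule dependent_nat_choice) (use step[OF W, of 0] next_ball in auto)
      then show ?thesis
        using that by blast
    qed
    define L where "L n = fst (x n)" for n
    define f where "f n = fst (snd (x n))" for n
    define r where "r n = snd (snd (x n))" for n
    have x_eq: "x n = (L n, f n, r n)" for n
      by (simp add: L_def f_def r_def)
    have L: "C n \<subseteq> L n" "L n \<subseteq> \<Omega>" and f: "f n \<in> Hol \<Omega>"
      and r: "0 < r n" "r n \<le> inverse (real (Suc n))" for n
      using x(1)[of n] by (auto simp: P_def x_eq)
    have "B 1 (x (Suc n)) \<subseteq> B 1 (x n)" for n
    proof -
      have "B 1 (x (Suc n)) \<subseteq> B 2 (x (Suc n))"
        unfolding B_def x_eq prod.case by (rule Hol_ball_antimono) (use r(1)[of "Suc n"] in auto)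
      then show ?thesis
        using x(3)[of n] by blast
    qed
    then have "B 1 (x m) \<subseteq> B 1 (x n)" if "n \<le> m" for m n
      using that by (rule lift_Suc_antimono_le)
    moreover have "f m \<in> B 1 (x m)" for m
      using Hol_ball_centre[OF f r(1)] by (simp add: B_def x_eq)
    ultimately have "f m \<in> B 1 (x n)" if "n \<le> m" for m n
      using that by blast
    \<comment> \<open>All later centres lie in the \<open>n\<close>-th ball. The sets
      \<open>L n\<close> need not increase, so the estimate holds only on \<open>L n\<close>
      itself.\<close>
    then have near: "dist (f m z) (f n z) < r n" if "n \<le> m" "z \<in> L n" for m n z
      using that by (auto simp: B_def x_eq Hol_ball_def)
    have r_tendsto: "r \<longlonglongrightarrow> 0"
      using r by (intro tendsto_sandwich[OF _ _ tendsto_const LIMSEQ_inverse_real_of_nat])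
        (auto simp: less_imp_le)
    \<comment> \<open>The pointwise limit, extended by 0 as membership in \<open>Hol\<close>
      demands.\<close>
    define g where "g z = (if z \<in> \<Omega> then lim (\<lambda>n. f n z) else 0)" for z
    have lim: "(\<lambda>n. f n z) \<longlonglongrightarrow> g z" if z: "z \<in> \<Omega>" for z
    proof -
      obtain N where N: "\<And>n. n \<ge> N \<Longrightarrow> z \<in> L n"
        using C(3)[of "{z}"] z L(1) by (auto simp: subset_iff)
      have "Cauchy (\<lambda>n. f n z)"
        unfolding metric_Cauchy_iff2
      proof (intro allI)
        fix j
        have "\<forall>\<^sub>F n in sequentially. r n < inverse (real (Suc j)) / 2"
          by (rule order_tendstoD[OF r_tendsto]) simp
        then obtain M where M: "\<And>n. n \<ge> M \<Longrightarrow> r n < inverse (real (Suc j)) / 2"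
          by (auto simp: eventually_sequentially)
        \<comment> \<open>From this index on, \<open>z\<close> lies in \<open>L n\<close> and twice
          the radius is below the target, so comparison with \<open>f n z\<close> suffices.\<close>
        define n where "n = max M N"
        have "dist (f m z) (f k z) < inverse (real (Suc j))" if "m \<ge> n" "k \<ge> n" for m k
          using near[OF that(1)] near[OF that(2)] N[of n] M[of n]
            dist_triangle2[of "f m z" "f k z" "f n z"] by (fastforce simp: n_def)
        then show "\<exists>M. \<forall>m\<ge>M. \<forall>n\<ge>M. dist (f m z) (f n z) < inverse (real (Suc j))"
          by blast
      qed
      then show ?thesis
        using z by (simp add: g_def Cauchy_convergent_iff convergent_LIMSEQ_iff)
    qed
    \<comment> \<open>Letting \<open>m\<close> tend to infinity in \<open>near\<close> weakens < to
      \<le>.\<close>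
    have g_near: "dist (g z) (f n z) \<le> r n" if "z \<in> L n" for n z
    proof (rule tendsto_upperbound)
      show "(\<lambda>m. dist (f m z) (f n z)) \<longlonglongrightarrow> dist (g z) (f n z)"
        using that L(2) by (intro tendsto_dist lim tendsto_const) auto
      show "\<forall>\<^sub>F m in sequentially. dist (f m z) (f n z) \<le> r n"
        using near that by (auto simp: eventually_sequentially intro!: exI[of _ n] less_imp_le)
    qed simp
    have g: "g \<in> Hol \<Omega>"
    proof (rule Hol_uniform_limit[OF \<open>open \<Omega>\<close> f])
      fix K
      assume K: "compact K" "K \<subseteq> \<Omega>"
      show "uniform_limit K f g sequentially"
      proof (rule uniform_limitI)
        fix e :: real
        assume "0 < e"
        have "\<forall>\<^sub>F n in sequentially. K \<subseteq> C n"
          using C(3)[OF K] by (simp add: eventually_sequentially)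
        moreover have "\<forall>\<^sub>F n in sequentially. r n < e"
          using order_tendstoD(2)[OF r_tendsto \<open>0 < e\<close>] .
        ultimately show "\<forall>\<^sub>F n in sequentially. \<forall>z\<in>K. dist (f n z) (g z) < e"
        proof eventually_elim
          case (elim n)
          show ?case
          proof
            fix z
            assume "z \<in> K"
            then have "z \<in> L n"
              using elim L(1) by blast
            from g_near[OF this] show "dist (f n z) (g z) < e"
              using elim by (simp add: dist_commute)
          qed
        qed
      qed
    qed (simp add: g_def)
    \<comment> \<open>The doubled radius restores strictness; the doubled balls lie in
      \<open>W\<close> at stage 0 and in \<open>V n\<close> at stage \<open>Suc n\<close>.\<close>
    have "g \<in> B 2 (x n)" for n
    proof -
      have "dist (g z) (f n z) < 2 * r n" if "z \<in> L n" for z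
        using g_near[OF that] r(1)[of n] by linarith
      then show ?thesis
        using g by (simp add: B_def x_eq Hol_ball_def)
    qed
    then have "g \<in> (\<Inter>n. V n) \<inter> W"
      using x(2,3) by blast
    then show ?thesis
      by blast
  qed
  then show ?thesis
    using dense_intersects_open[of "Hol_topology \<Omega>" "\<Inter>n. V n"] by auto
qed

section \<open>Openness and density of the sets of unbounded functions\<close>

text \<open>A union over \<open>z\<close> of preimages of an open set; continuity at each fixed
  \<open>z\<close> is enough, with no uniformity in \<open>z\<close>.\<close>

lemma openin_exceeds:
  assumes "\<And>z. z \<in> A \<Longrightarrow> continuous_map X euclidean (\<lambda>f. T f z :: 'a::real_normed_vector)"
  shows "openin X {f \<in> topspace X. \<exists>z\<in>A. k < norm (T f z)}"
proof -
  have "openin X {f \<in> topspace X. T f z \<in> {w. k < norm w}}" if "z \<in> A" for z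
    by (rule openin_continuous_map_preimage[OF assms[OF that]])
      (simp add: open_Collect_less continuous_intros)
  then have "openin X (\<Union>z\<in>A. {f \<in> topspace X. T f z \<in> {w. k < norm w}})"
    by blast
  moreover have "(\<Union>z\<in>A. {f \<in> topspace X. T f z \<in> {w. k < norm w}}) =
      {f \<in> topspace X. \<exists>z\<in>A. k < norm (T f z)}"
    by auto
  ultimately show ?thesis
    by simp
qed

text \<open>Natural number bounds suffice by the Archimedean property, which keeps the intersection
  countable.\<close>

lemma unbounded_set_eq_INT:
  "unbounded_set \<Omega>1 \<Omega>2 T = (\<Inter>k::nat. {f \<in> Hol \<Omega>1. \<exists>z\<in>\<Omega>2. real k < norm (T f z)})"
proof -
  have "\<not> bounded (T f ` \<Omega>2) \<longleftrightarrow> (\<forall>k::nat. \<exists>z\<in>\<Omega>2. real k < norm (T f z))" for f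
  proof -
    have "bounded (T f ` \<Omega>2) \<longleftrightarrow> (\<exists>k::nat. \<forall>z\<in>\<Omega>2. norm (T f z) \<le> real k)"
      unfolding bounded_iff by (auto intro: order_trans real_arch_simple dest: bspec)
        (meson order_trans real_arch_simple)
    then show ?thesis
      by (auto simp: not_le)
  qed
  then show ?thesis
    by (auto simp: unbounded_set_def)
qed

lemma unbounded_set_dense:
  assumes lin: "linear_Hol \<Omega>1 \<Omega>2 T" and ne: "unbounded_set \<Omega>1 \<Omega>2 T \<noteq> {}"
  shows "Hol_topology \<Omega>1 closure_of unbounded_set \<Omega>1 \<Omega>2 T = Hol \<Omega>1"
proof -
  obtain g where g: "g \<in> Hol \<Omega>1" "\<not> bounded (T g ` \<Omega>2)"
    using ne by (auto simp: unbounded_set_def)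
  have "unbounded_set \<Omega>1 \<Omega>2 T \<inter> W \<noteq> {}" if W: "openin (Hol_topology \<Omega>1) W" "W \<noteq> {}" for W
  proof -
    obtain f K e where f: "f \<in> W" "f \<in> Hol \<Omega>1"
      and K: "compact K" "K \<subseteq> \<Omega>1" "0 < e" "Hol_ball \<Omega>1 K f e \<subseteq> W"
      using W unfolding openin_Hol_topology by blast
    show ?thesis
    proof (cases "bounded (T f ` \<Omega>2)")
      case False
      then show ?thesis
        using f by (auto simp: unbounded_set_def)
    next
      case True
      have "continuous_on K g"
        using g(1) K(2)
        by (auto simp: Hol_def intro: holomorphic_on_imp_continuous_on continuous_on_subset)
      then have "bounded (g ` K)"
        using K(1) compact_continuous_image compact_imp_bounded by blast
      then obtain M where M: "0 < M" "\<And>z. z \<in> K \<Longrightarrow> norm (g z) \<le> M"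
        by (auto simp: bounded_pos)
      \<comment> \<open>Nonzero, yet small enough that \<open>c * g\<close> has modulus at most
        \<open>e / 2\<close> on \<open>K\<close>.\<close>
      define c where "c = complex_of_real (e / (2 * M))"
      have c: "c \<noteq> 0"
        using K(3) M(1) by (simp add: c_def)
      define h where "h z = f z + c * g z" for z
      have h: "h \<in> Hol \<Omega>1"
        unfolding h_def using f(2) g(1) by (rule Hol_linear_combination)
      have "dist (h z) (f z) < e" if "z \<in> K" for z
      proof -
        have "dist (h z) (f z) = e / (2 * M) * norm (g z)"
          using K(3) M(1) by (simp add: h_def dist_norm norm_mult norm_divide c_def)
        also have "\<dots> \<le> e / (2 * M) * M"
          using M that K(3) by (intro mult_left_mono) auto
        also have "\<dots> < e"
          using K(3) M(1) by simp
        finally show ?thesis .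
      qed
      with h K(4) have "h \<in> W"
        by (auto simp: Hol_ball_def)
      moreover have "\<not> bounded (T h ` \<Omega>2)"
      proof
        assume "bounded (T h ` \<Omega>2)"
        \<comment> \<open>By linearity the image is that of \<open>T g\<close>, recovered as (T h -
          T f) / c.\<close>
        then have "bounded ((*) (inverse c) ` ((\<lambda>z. T h z - T f z) ` \<Omega>2))"
          using True by (intro bounded_linear_image[OF _ bounded_linear_mult_right] bounded_minus_comp)
        moreover have "T h = (\<lambda>z. T f z + c * T g z)"
        proof -
          have "(\<lambda>z. c * g z) \<in> Hol \<Omega>1"
            using g(1) by (auto simp: Hol_def intro!: holomorphic_intros)
          then show ?thesis
            using lin f(2) g(1) by (simp add: linear_Hol_def h_def[abs_def])
        qed
        ultimately have "bounded (T g ` \<Omega>2)"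
          using c by (simp add: image_image flip: mult.assoc)
        with g(2) show False ..
      qed
      ultimately show ?thesis
        using h by (auto simp: unbounded_set_def)
    qed
  qed
  then show ?thesis
    using dense_intersects_open[of "Hol_topology \<Omega>1" "unbounded_set \<Omega>1 \<Omega>2 T"]
    by auto
qed

theorem proposition2p2:
  fixes \<Omega>1 \<Omega>2 :: "complex set"
    and T :: "int \<Rightarrow> (complex \<Rightarrow> complex) \<Rightarrow> complex \<Rightarrow> complex"
  assumes "complex_domain \<Omega>1" and "complex_domain \<Omega>2"
    and "\<And>n. linear_Hol \<Omega>1 \<Omega>2 (T n)"
    and "\<And>n z. z \<in> \<Omega>2 \<Longrightarrow> continuous_map (Hol_topology \<Omega>1) euclidean (\<lambda>f. T n f z)"
    and "\<And>n. unbounded_set \<Omega>1 \<Omega>2 (T n) \<noteq> {}"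
  shows "gdelta_in (Hol_topology \<Omega>1) (\<Inter>n. unbounded_set \<Omega>1 \<Omega>2 (T n))
    \<and> Hol_topology \<Omega>1 closure_of (\<Inter>n. unbounded_set \<Omega>1 \<Omega>2 (T n)) = Hol \<Omega>1"
proof -
  let ?X = "Hol_topology \<Omega>1"
  \<comment> \<open>Indexing by pairs merges the two countable intersections into one family of open
    sets.\<close>
  define V where "V p = (case p of (n, k) \<Rightarrow>
    {f \<in> Hol \<Omega>1. \<exists>z\<in>\<Omega>2. real k < norm (T n f z)})" for p :: "int \<times> nat"
  have eq: "(\<Inter>n. unbounded_set \<Omega>1 \<Omega>2 (T n)) = (\<Inter>p. V p)"
    by (auto simp: unbounded_set_eq_INT V_def)
  have op: "openin ?X (V p)" for p
    using openin_exceeds[of \<Omega>2 ?X "T (fst p)" "real (snd p)"] assms(4)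
    by (simp add: V_def split_beta)
  have dense: "?X closure_of V p = Hol \<Omega>1" for p
  proof -
    have "unbounded_set \<Omega>1 \<Omega>2 (T (fst p)) \<subseteq> V p"
      by (auto simp: unbounded_set_eq_INT V_def split_beta)
    from closure_of_mono[OF this, of ?X] show ?thesis
      using unbounded_set_dense[OF assms(3,5)] closure_of_subset_topspace[of ?X "V p"] by auto
  qed
  have "gdelta_in ?X (\<Inter>p. V p)"
    by (rule gdelta_in_Inter) (auto intro: open_imp_gdelta_in op)
  \<comment> \<open>\<open>Hol_Baire\<close> expects a sequence, so the countable index type is
    enumerated by \<open>from_nat\<close>.\<close>
  moreover have "?X closure_of (\<Inter>m::nat. V (from_nat m)) = Hol \<Omega>1"
    using assms(1) op dense by (intro Hol_Baire) (auto simp: complex_domain_def)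
  moreover have "(\<Inter>m::nat. V (from_nat m)) = (\<Inter>p. V p)"
    using surj_from_nat[where 'a = "int \<times> nat"] by (metis image_image)
  ultimately show ?thesis
    by (simp add: eq)
qed

end
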